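(* Let $v=p_1^{r_1}\cdots p_a^{r_a}q_1^{s_1}\cdots q_b^{s_b}$, where $p_1,\dots,p_a,q_1,\dots,q_b$ are distinct primes, each $p_i$ satisfies $p_i\equiv 1\pmod 6$ or $p_i=3$, and each $q_i\equiv 2\pmod 3$. If every $s_i$ ($1\le i\le b$) is even, then there exists an affine Mendelsohn triple system of order $v$.
   Context: A Mendelsohn triple system MTS($v$) is a pair $(V,\mathcal B)$ with $|V|=v$ and $\mathcal B$ a collection of cyclically ordered triples $\langle x,y,z\rangle$ (containing the ordered pairs $(x,y),(y,z),(z,x)$) such that every ordered pair of distinct elements of $V$ lies in exactly one block. Its associated quasigroup $(V,\circ)$ is given by $x\circ x=x$ and $x\circ y=z$ whenever $\langle x,y,z\rangle\in\mathcal B$. The system is affine if its associated quasigroup is isomorphic to some $\mathrm{Aff}(G,k)=(G,*_k)$, $x*_k y=(x-k(x))+k(y)$, where $(G,+)$ is an Abelian group and $k$ and $I-k$ are automorphisms of $G$. *)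

theory Defs
  imports "HOL-Algebra.Group" "HOL-Number_Theory.Cong"
begin

text \<open>A cyclically ordered triple is represented by the set of ordered pairs it contains. For
  pairwise distinct entries, two such sets agree iff the triples are rotations of each other.\<close>

definition cyclic_triple :: "'a \<Rightarrow> 'a \<Rightarrow> 'a \<Rightarrow> ('a \<times> 'a) set" where
  "cyclic_triple x y z = {(x, y), (y, z), (z, x)}"

definition mendelsohn_triple_system :: "nat \<Rightarrow> 'a set \<Rightarrow> ('a \<times> 'a) set set \<Rightarrow> bool" where
  "mendelsohn_triple_system v V B \<longleftrightarrow>
     finite V \<and> card V = v \<and>
     (\<forall>b\<in>B. \<exists>x\<in>V. \<exists>y\<in>V. \<exists>z\<in>V. x \<noteq> y \<and> y \<noteq> z \<and> x \<noteq> z \<and> b = cyclic_triple x y z) \<and>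
     (\<forall>x\<in>V. \<forall>y\<in>V. x \<noteq> y \<longrightarrow> (\<exists>!b. b \<in> B \<and> (x, y) \<in> b))"

definition mts_op :: "('a \<times> 'a) set set \<Rightarrow> 'a \<Rightarrow> 'a \<Rightarrow> 'a" where
  "mts_op B x y = (if x = y then x else (THE z. cyclic_triple x y z \<in> B))"

text \<open>Abelian groups are written multiplicatively, as in \<^locale>\<open>comm_group\<close>: below,
  \<open>x \<otimes> inv (k x)\<close> is \<open>x - k(x)\<close>, so \<open>aff_op\<close> is \<open>(x - k(x)) + k(y)\<close>.\<close>

definition aff_data :: "('a, 'c) monoid_scheme \<Rightarrow> ('a \<Rightarrow> 'a) \<Rightarrow> bool" where
  "aff_data G k \<longleftrightarrow>
     comm_group G \<and> k \<in> iso G G \<and> (\<lambda>x. x \<otimes>\<^bsub>G\<^esub> inv\<^bsub>G\<^esub> (k x)) \<in> iso G G"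

definition aff_op :: "('a, 'c) monoid_scheme \<Rightarrow> ('a \<Rightarrow> 'a) \<Rightarrow> 'a \<Rightarrow> 'a \<Rightarrow> 'a" where
  "aff_op G k x y = (x \<otimes>\<^bsub>G\<^esub> inv\<^bsub>G\<^esub> (k x)) \<otimes>\<^bsub>G\<^esub> k y"

definition binop_isomorphic ::
  "'a set \<Rightarrow> ('a \<Rightarrow> 'a \<Rightarrow> 'a) \<Rightarrow> 'b set \<Rightarrow> ('b \<Rightarrow> 'b \<Rightarrow> 'b) \<Rightarrow> bool" where
  "binop_isomorphic A f C g \<longleftrightarrow>
     (\<exists>h. bij_betw h A C \<and> (\<forall>x\<in>A. \<forall>y\<in>A. h (f x y) = g (h x) (h y)))"

text \<open>The group \<open>G\<close> may be taken on the type of the points without loss of generality: the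
  isomorphism is a bijection onto the carrier of \<open>G\<close>, along which the group structure and \<open>k\<close>
  can be transported to the point set.\<close>

definition affine_mts :: "nat \<Rightarrow> 'a set \<Rightarrow> ('a \<times> 'a) set set \<Rightarrow> bool" where
  "affine_mts v V B \<longleftrightarrow>
     mendelsohn_triple_system v V B \<and>
     (\<exists>(G :: 'a monoid) k. aff_data G k \<and>
        binop_isomorphic V (mts_op B) (carrier G) (aff_op G k))"

end

theory Submission
  imports Defs "HOL-Algebra.Elementary_Groups" "HOL-Number_Theory.Residue_Primitive_Roots"
begin

text \<open>If an endomorphism \<open>k\<close> of an abelian group satisfies \<open>k\<^sup>2 - k + 1 = 0\<close>, then
  \<open>k (1 - k) = 1\<close>, so \<open>k\<close> and \<open>1 - k\<close> are automorphisms, and the operation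
  \<open>x * y = (x - k x) + k y\<close> satisfies \<open>y * (x * y) = x\<close>; hence the triples
  \<open>\<langle>x, y, x * y\<rangle>\<close> form a Mendelsohn triple system. The orders of finite groups with such
  an endomorphism are closed under products. A prime \<open>p \<equiv> 1 (mod 6)\<close> is such an order because
  \<open>\<int>/p\<close> contains a primitive sixth root of unity; for \<open>3\<close> take \<open>k = 2\<close>; and every square
  \<open>n\<^sup>2\<close> is one because of \<open>k (x, y) = (- y, x + y)\<close> on \<open>(\<int>/n)\<^sup>2\<close>.\<close>

section \<open>Triple systems from semisymmetric operations\<close>

locale semisymmetric_idempotent =
  fixes V :: "'a set" and f :: "'a \<Rightarrow> 'a \<Rightarrow> 'a"
  assumes closed: "x \<in> V \<Longrightarrow> y \<in> V \<Longrightarrow> f x y \<in> V"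
    and idem: "x \<in> V \<Longrightarrow> f x x = x"
    and semisym: "x \<in> V \<Longrightarrow> y \<in> V \<Longrightarrow> f y (f x y) = x"
begin

text \<open>Apply \<open>semisym\<close> to the pair \<open>y\<close>, \<open>f x y\<close>, then
  once more to rewrite the inner term \<open>f y (f x y)\<close> to \<open>x\<close>.\<close>

lemma semisym': "x \<in> V \<Longrightarrow> y \<in> V \<Longrightarrow> f (f x y) x = y"
  by (metis closed semisym)

lemma op_neq:
  assumes "x \<in> V" "y \<in> V" "x \<noteq> y"
  shows "f x y \<noteq> x" "f x y \<noteq> y"
  using assms by (metis idem semisym semisym')+

definition triples :: "('a \<times> 'a) set set" where
  "triples = {cyclic_triple x y (f x y) | x y. x \<in> V \<and> y \<in> V \<and> x \<noteq> y}"

text \<open>Semisymmetry makes each rotation of \<open>u, w, f u w\<close> again a pair followed by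
  its product, so any of its three pairs determines a block.\<close>

lemma triples_unique:
  assumes "b \<in> triples" "(x, y) \<in> b"
  shows "b = cyclic_triple x y (f x y)"
proof -
  obtain u w where uw: "u \<in> V" "w \<in> V" and b: "b = cyclic_triple u w (f u w)"
    using assms(1) by (auto simp: triples_def)
  consider "x = u" "y = w" | "x = w" "y = f u w" | "x = f u w" "y = u"
    using assms(2) by (auto simp: b cyclic_triple_def)
  then show ?thesis
    by cases (simp_all add: b uw semisym semisym' cyclic_triple_def insert_commute)
qed

lemma mendelsohn_triples:
  assumes "finite V"
  shows "mendelsohn_triple_system (card V) V triples"
  unfolding mendelsohn_triple_system_def
proof (intro conjI ballI impI)
  fix b assume "b \<in> triples"
  then show "\<exists>x\<in>V. \<exists>y\<in>V. \<exists>z\<in>V. x \<noteq> y \<and> y \<noteq> z \<and> x \<noteq> z \<and> b = cyclic_triple x y z"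
    unfolding triples_def by (smt (verit) closed mem_Collect_eq op_neq)
next
  fix x y assume "x \<in> V" "y \<in> V" "x \<noteq> y"
  then have "cyclic_triple x y (f x y) \<in> triples \<and> (x, y) \<in> cyclic_triple x y (f x y)"
    by (auto simp: triples_def cyclic_triple_def)
  then show "\<exists>!b. b \<in> triples \<and> (x, y) \<in> b"
    using triples_unique by blast
qed (use assms in auto)

lemma mts_op_triples:
  assumes "x \<in> V" "y \<in> V"
  shows "mts_op triples x y = f x y"
proof (cases "x = y")
  case False
  have "z = f x y" if "cyclic_triple x y z \<in> triples" for z
  proof -
    have "cyclic_triple x y z = cyclic_triple x y (f x y)"
      using triples_unique[OF that] by (simp add: cyclic_triple_def)
    \<comment> \<open>As \<open>y\<close> differs from \<open>x\<close> and \<open>f x y\<close>,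
      only one pair of this block starts with \<open>y\<close>; its second entry is
      \<open>f x y\<close>.\<close>
    then have "(y, z) \<in> cyclic_triple x y (f x y)"
      by (auto simp: cyclic_triple_def)
    then show ?thesis
      using False op_neq[OF assms False] by (auto simp: cyclic_triple_def)
  qed
  moreover have "cyclic_triple x y (f x y) \<in> triples"
    using assms False by (auto simp: triples_def)
  ultimately have "(THE z. cyclic_triple x y z \<in> triples) = f x y"
    by (intro the_equality)
  with False show ?thesis
    by (simp add: mts_op_def)
qed (use assms in \<open>simp add: mts_op_def idem\<close>)

end

section \<open>Endomorphisms with \<open>k\<^sup>2 - k + 1 = 0\<close>\<close>

lemma (in group) mult_inv_cancel: "x \<in> carrier G \<Longrightarrow> y \<in> carrier G \<Longrightarrow> x \<otimes> (inv x \<otimes> y) = y"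
  by (simp flip: m_assoc)

lemma (in group) inv_mult_cancel: "x \<in> carrier G \<Longrightarrow> y \<in> carrier G \<Longrightarrow> inv x \<otimes> (x \<otimes> y) = y"
  by (simp flip: m_assoc)

lemma (in comm_group) mult_inv_cancel2:
  "x \<in> carrier G \<Longrightarrow> y \<in> carrier G \<Longrightarrow> x \<otimes> (y \<otimes> (inv x \<otimes> inv y)) = \<one>"
  by (simp add: m_lcomm[of y] mult_inv_cancel)

text \<open>Such a \<open>k\<close> makes the group a module over the Eisenstein integers, with \<open>- k\<close> acting as a
  primitive cube root of unity.\<close>

definition eisenstein_endo :: "('a, 'c) monoid_scheme \<Rightarrow> ('a \<Rightarrow> 'a) \<Rightarrow> bool" where
  "eisenstein_endo G k \<longleftrightarrow>
     comm_group G \<and> k \<in> hom G G \<and> (\<forall>x\<in>carrier G. k (k x) \<otimes>\<^bsub>G\<^esub> x = k x)"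

context
  fixes G :: "('a, 'c) monoid_scheme" (structure) and k :: "'a \<Rightarrow> 'a"
  assumes k: "eisenstein_endo G k"
begin

interpretation comm_group G
  using k by (simp add: eisenstein_endo_def)

lemma eisenstein_endo_hom: "k \<in> hom G G"
  using k by (simp add: eisenstein_endo_def)

lemma eisenstein_endo_closed: "x \<in> carrier G \<Longrightarrow> k x \<in> carrier G"
  using eisenstein_endo_hom by (auto simp: hom_def)

lemma eisenstein_endo_mult:
  "x \<in> carrier G \<Longrightarrow> y \<in> carrier G \<Longrightarrow> k (x \<otimes> y) = k x \<otimes> k y"
  using eisenstein_endo_hom by (auto simp: hom_def)

lemma eisenstein_endo_inv: "x \<in> carrier G \<Longrightarrow> k (inv x) = inv (k x)"
  using group_hom.hom_inv[of G G k] eisenstein_endo_hom is_group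
  by (simp add: group_hom_def group_hom_axioms_def)

lemma eisenstein_endo_twice: "x \<in> carrier G \<Longrightarrow> k (k x) = k x \<otimes> inv x"
  using k eisenstein_endo_closed by (simp add: eisenstein_endo_def inv_solve_right)

text \<open>Rewrites every term to a sorted product of elements, their images under a single
  \<open>k\<close>, and inverses of these; the cancellation lemmas then finish.\<close>

lemmas eisenstein_simps = eisenstein_endo_closed eisenstein_endo_mult eisenstein_endo_inv
  eisenstein_endo_twice inv_mult m_ac

lemma eisenstein_endo_aff_data: "aff_data G k"
proof -
  let ?d = "\<lambda>x. x \<otimes> inv (k x)"
  have kd: "k (?d x) = x" and dk: "?d (k x) = x" if "x \<in> carrier G" for x
    using that by (simp_all add: eisenstein_simps mult_inv_cancel inv_mult_cancel)
  have "?d \<in> hom G G"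
    by (auto simp: hom_def eisenstein_simps)
  moreover have "bij_betw k (carrier G) (carrier G)" "bij_betw ?d (carrier G) (carrier G)"
    by (rule bij_betw_byWitness[where f' = ?d] bij_betw_byWitness[where f' = k];
        use kd dk eisenstein_endo_closed in force)+
  ultimately show ?thesis
    using eisenstein_endo_hom comm_group_axioms by (simp add: aff_data_def iso_def)
qed

lemma eisenstein_endo_semisymmetric: "semisymmetric_idempotent (carrier G) (aff_op G k)"
proof
  fix x y assume "x \<in> carrier G" "y \<in> carrier G"
  then show "aff_op G k x y \<in> carrier G" "aff_op G k x x = x" "aff_op G k y (aff_op G k x y) = x"
    by (simp_all add: aff_op_def eisenstein_simps mult_inv_cancel inv_mult_cancel mult_inv_cancel2)
qed

end

lemma eisenstein_endo_imp_affine_mts: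
  fixes G :: "'a monoid"
  assumes "eisenstein_endo G k" "finite (carrier G)"
  shows "\<exists>B. affine_mts (order G) (carrier G) B"
proof -
  interpret semisymmetric_idempotent "carrier G" "aff_op G k"
    using assms(1) by (rule eisenstein_endo_semisymmetric)
  have "binop_isomorphic (carrier G) (mts_op triples) (carrier G) (aff_op G k)"
    unfolding binop_isomorphic_def by (rule exI[of _ id]) (simp add: mts_op_triples)
  then show ?thesis
    unfolding affine_mts_def order_def
    using mendelsohn_triples[OF assms(2)] eisenstein_endo_aff_data[OF assms(1)] by blast
qed

section \<open>Orders of groups with such an endomorphism\<close>

text \<open>A definition cannot quantify over types, so one type is fixed; \<open>nat\<close> has
  room for every finite group and is the point type of the theorem.\<close>

definition eisenstein_order :: "nat \<Rightarrow> bool" where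
  "eisenstein_order n \<longleftrightarrow>
     (\<exists>(G :: nat monoid) k. eisenstein_endo G k \<and> finite (carrier G) \<and> order G = n)"

text \<open>Group and endomorphism are transported along a bijection onto an initial segment of
  \<open>nat\<close>, which admits products and groups of integers as examples.\<close>

lemma eisenstein_orderI:
  fixes G :: "('a, 'c) monoid_scheme" (structure)
  assumes k: "eisenstein_endo G k" and fin: "finite (carrier G)"
  shows "eisenstein_order (order G)"
proof -
  interpret comm_group G
    using k by (simp add: eisenstein_endo_def)
  obtain f where f: "bij_betw f (carrier G) {0..<order G}"
    using ex_bij_betw_finite_nat[OF fin] by (auto simp: order_def)
  define g where "g = inv_into (carrier G) f"
  have gf: "g (f x) = x" if "x \<in> carrier G" for x
    using f that by (simp add: g_def bij_betw_inv_into_left)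
  define H where
    "H = \<lparr>carrier = f ` carrier G, monoid.mult = (\<lambda>x y. f (g x \<otimes> g y)), one = f \<one>\<rparr>"
  have "comm_group H"
  proof (rule comm_groupI)
    fix x assume "x \<in> carrier H"
    then obtain a where a: "a \<in> carrier G" "x = f a" by (auto simp: H_def)
    then show "\<exists>y\<in>carrier H. y \<otimes>\<^bsub>H\<^esub> x = \<one>\<^bsub>H\<^esub>"
      by (intro bexI[of _ "f (inv a)"]) (auto simp: H_def gf)
  qed (auto simp: H_def gf m_ac)
  then have "eisenstein_endo H (\<lambda>x. f (k (g x)))"
    using k by (auto simp: eisenstein_endo_def hom_def H_def gf Pi_iff)
  moreover have "order H = order G"
    using f by (simp add: H_def order_def bij_betw_def)
  moreover have "finite (carrier H)"
    using fin by (simp add: H_def)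
  ultimately show ?thesis
    unfolding eisenstein_order_def by blast
qed

lemma comm_group_DirProd:
  assumes "comm_group G" "comm_group H"
  shows "comm_group (G \<times>\<times> H)"
proof -
  interpret G: comm_group G by fact
  interpret H: comm_group H by fact
  interpret group "G \<times>\<times> H"
    by (intro DirProd_group G.is_group H.is_group)
  show ?thesis
    by (rule group_comm_groupI) (auto simp: G.m_comm H.m_comm)
qed

lemma eisenstein_order_mult:
  assumes "eisenstein_order m" "eisenstein_order n"
  shows "eisenstein_order (m * n)"
proof -
  obtain G k where G: "eisenstein_endo (G :: nat monoid) k" "finite (carrier G)" "order G = m"
    using assms(1) by (auto simp: eisenstein_order_def)
  obtain H l where H: "eisenstein_endo (H :: nat monoid) l" "finite (carrier H)" "order H = n"
    using assms(2) by (auto simp: eisenstein_order_def)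
  have "eisenstein_endo (G \<times>\<times> H) (\<lambda>(x, y). (k x, l y))"
    using G(1) H(1) by (auto simp: eisenstein_endo_def comm_group_DirProd hom_def Pi_iff)
  from eisenstein_orderI[OF this] show ?thesis
    using G H by (simp add: order_def card_cartesian_product)
qed

text \<open>Multiplication by a root \<open>c\<close> of the polynomial modulo \<open>n\<close> is
  the endomorphism of the cyclic group.\<close>

lemma eisenstein_order_root:
  assumes "n > 0" and root: "int n dvd c\<^sup>2 - c + 1"
  shows "eisenstein_order n"
proof -
  let ?G = "integer_mod_group n" and ?k = "\<lambda>x. c * x mod int n"
  have "(c * (c * x) + x) mod int n = c * x mod int n" for x
  proof -
    have "int n dvd (c\<^sup>2 - c + 1) * x"
      using root by simp
    then show ?thesis
      by (simp add: mod_eq_dvd_iff algebra_simps power2_eq_square)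
  qed
  then have "eisenstein_endo ?G ?k"
    using assms(1)
    by (auto simp: eisenstein_endo_def hom_def carrier_integer_mod_group mod_simps distrib_left)
  from eisenstein_orderI[OF this] show ?thesis
    using assms(1) by (simp add: order_def carrier_integer_mod_group)
qed

text \<open>The matrix of \<open>?k\<close> has trace 1 and determinant 1, so the identity is
  Cayley-Hamilton and holds even if the polynomial has no root modulo \<open>n\<close>.\<close>

lemma eisenstein_order_square:
  assumes "n > 0"
  shows "eisenstein_order (n\<^sup>2)"
proof -
  let ?G = "integer_mod_group n"
  let ?k = "\<lambda>(x, y). (- y mod int n, (x + y) mod int n)"
  have "eisenstein_endo (?G \<times>\<times> ?G) ?k"
    using assms by (auto simp: eisenstein_endo_def comm_group_DirProd hom_def
        carrier_integer_mod_group mod_simps minus_diff_commute) (simp_all add: ac_simps)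
  from eisenstein_orderI[OF this] show ?thesis
    using assms
    by (simp add: order_def carrier_integer_mod_group card_cartesian_product power2_eq_square)
qed

lemma eisenstein_order_power: "eisenstein_order n \<Longrightarrow> eisenstein_order (n ^ r)"
proof (induction r)
  case 0
  \<comment> \<open>The trivial group: modulo 1 every \<open>c\<close> is a root.\<close>
  show ?case using eisenstein_order_root[of 1] by simp
qed (simp add: eisenstein_order_mult)

lemma eisenstein_order_prod:
  "(\<And>i. i \<in> A \<Longrightarrow> eisenstein_order (f i)) \<Longrightarrow> eisenstein_order (prod f A)"
proof (induction A rule: infinite_finite_induct)
  case (insert x A)
  then show ?case by (simp add: eisenstein_order_mult)
qed (use eisenstein_order_root[of 1] in simp_all)

text \<open>A primitive root raised to \<open>(p - 1) / 3\<close> is a primitive cube root of unity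
  \<open>w\<close>, and \<open>- w\<close> is the desired root.\<close>

lemma prime_root_exists:
  fixes p :: nat
  assumes "prime p" "[p = 1] (mod 3)"
  obtains c :: int where "int p dvd c\<^sup>2 - c + 1"
proof -
  have p: "p > 1" using assms(1) prime_gt_1_nat by blast
  obtain g where "residue_primroot p g"
    using prime_primitive_root_exists[OF _ assms(1)] p by auto
  then have g: "coprime p g" "ord p g = p - 1"
    using assms(1) by (auto simp: residue_primroot_def totient_prime)
  have "3 dvd p - 1"
    using assms(2) p by (metis cong_altdef_nat less_imp_le)
  then obtain m where m: "p - 1 = 3 * m" ..
  define w where "w = int (g ^ m)"
  \<comment> \<open>The order of \<open>g\<close> is \<open>3 * m\<close> with \<open>m > 0\<close>,
    so it cannot divide \<open>m\<close>.\<close>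
  have "\<not> [g ^ m = 1] (mod p)"
    using m p g(2) by (subst ord_divides) (auto dest: dvd_imp_le)
  then have "\<not> int p dvd w - 1"
    by (metis w_def cong_iff_dvd_diff cong_int_iff of_nat_1)
  moreover have "[(g ^ m) ^ 3 = 1] (mod p)"
    using ord[of g p] g(2) m by (simp add: mult.commute flip: power_mult)
  then have "int p dvd w ^ 3 - 1"
    unfolding w_def by (metis cong_iff_dvd_diff cong_int_iff of_nat_1 of_nat_power)
  \<comment> \<open>The second factor is \<open>w\<^sup>2 + w + 1\<close>, the cofactor of
    \<open>w - 1\<close> in \<open>w ^ 3 - 1\<close>.\<close>
  then have "int p dvd (w - 1) * ((- w)\<^sup>2 - (- w) + 1)"
    by (simp add: algebra_simps power2_eq_square power3_eq_cube)
  ultimately show thesis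
    using assms(1) that[of "- w"] prime_dvd_mult_iff[of "int p"] by simp
qed

theorem theorem2p7:
  fixes v a b :: nat and p r q s :: "nat \<Rightarrow> nat"
  assumes "v = (\<Prod>i=1..a. p i ^ r i) * (\<Prod>i=1..b. q i ^ s i)"
    and "\<And>i. i \<in> {1..a} \<Longrightarrow> prime (p i)"
    and "\<And>i. i \<in> {1..b} \<Longrightarrow> prime (q i)"
    and "inj_on p {1..a}" and "inj_on q {1..b}" and "p ` {1..a} \<inter> q ` {1..b} = {}"
    and "\<And>i. i \<in> {1..a} \<Longrightarrow> [p i = 1] (mod 6) \<or> p i = 3"
    and "\<And>i. i \<in> {1..b} \<Longrightarrow> [q i = 2] (mod 3)"
    and "\<And>i. i \<in> {1..b} \<Longrightarrow> even (s i)"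
  shows "\<exists>(V :: nat set) B. affine_mts v V B"
proof -
  have "eisenstein_order (p i)" if i: "i \<in> {1..a}" for i
  proof -
    obtain c where "int (p i) dvd c\<^sup>2 - c + 1"
    proof (cases "p i = 3")
      case True
      then show thesis using that[of 2] by simp
    next
      case False
      then have "[p i = 1] (mod 3)"
        using assms(7)[OF i] cong_dvd_modulus_nat[of "p i" 1 6 3] by simp
      then show thesis
        using prime_root_exists assms(2)[OF i] that by blast
    qed
    then show ?thesis
      using eisenstein_order_root assms(2)[OF i] prime_gt_0_nat by blast
  qed
  moreover have "eisenstein_order (q i ^ s i)" if i: "i \<in> {1..b}" for i
  proof -
    \<comment> \<open>With the 2 on the right, \<open>power_mult\<close> turns the power into the
      square of \<open>q i ^ t\<close>.\<close>
    obtain t where "s i = t * 2"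
      using assms(9)[OF i] by (metis dvd_def mult.commute)
    then show ?thesis
      using eisenstein_order_square[of "q i ^ t"] prime_gt_0_nat[OF assms(3)[OF i]]
      by (simp add: power_mult)
  qed
  ultimately have "eisenstein_order v"
    unfolding assms(1)
    by (intro eisenstein_order_mult eisenstein_order_prod) (simp_all add: eisenstein_order_power)
  then show ?thesis
    using eisenstein_endo_imp_affine_mts unfolding eisenstein_order_def by metis
qed

end
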